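(* Identify $\mathbb{R}^4$, with coordinates $(q_1,q_2,q_3,q_4)$, with $\mathbb{C}^2$ via $z_1=q_1+iq_2$, $z_2=q_3-iq_4$. Let $\phi$ be a holomorphic function (on an open subset) of the form $$\phi(z_1,z_2)=z_1z_2+a(z_1)+b(z_2),$$ where $a$ and $b$ are holomorphic functions of one variable. Then the real part $f=\operatorname{Re}\phi$, viewed as a function of $(q_1,q_2,q_3,q_4)$, is a regular solution of the Plebanski I equation.
   Context: The Plebanski I equation for a function $f$ of $(q_1,q_2,q_3,q_4)$ is $$\frac{\partial^2 f}{\partial q_1\partial q_3}\frac{\partial^2 f}{\partial q_2\partial q_4}-\frac{\partial^2 f}{\partial q_1\partial q_4}\frac{\partial^2 f}{\partial q_2\partial q_3}=1 .$$ A regular solution is a smooth function $f$ satisfying this equation on its domain. *)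

theory Defs
  imports "HOL-Complex_Analysis.Complex_Analysis"
begin

definition partial :: "4 \<Rightarrow> (real ^ 4 \<Rightarrow> real) \<Rightarrow> real ^ 4 \<Rightarrow> real" where
  "partial i f q = deriv (\<lambda>t. f (q + t *\<^sub>R axis i 1)) 0"

fun C_k_on :: "nat \<Rightarrow> (real ^ 4 \<Rightarrow> real) \<Rightarrow> (real ^ 4) set \<Rightarrow> bool" where
  "C_k_on 0 f D \<longleftrightarrow> continuous_on D f"
| "C_k_on (Suc k) f D \<longleftrightarrow>
     (\<forall>q\<in>D. f differentiable (at q)) \<and> (\<forall>i. C_k_on k (partial i f) D)"

definition smooth_on :: "(real ^ 4) set \<Rightarrow> (real ^ 4 \<Rightarrow> real) \<Rightarrow> bool" where
  "smooth_on D f \<longleftrightarrow> (\<forall>k. C_k_on k f D)"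

(* Functions are total in HOL, so the domain D of f is an explicit argument. *)
definition plebanski_I_regular_solution :: "(real ^ 4) set \<Rightarrow> (real ^ 4 \<Rightarrow> real) \<Rightarrow> bool" where
  "plebanski_I_regular_solution D f \<longleftrightarrow>
     open D \<and> smooth_on D f \<and>
     (\<forall>q\<in>D. partial 1 (partial 3 f) q * partial 2 (partial 4 f) q
            - partial 1 (partial 4 f) q * partial 2 (partial 3 f) q = 1)"

(* The minus sign in the second component is intended: z2 = q3 - i q4. *)
definition to_C2 :: "real ^ 4 \<Rightarrow> complex \<times> complex" where
  "to_C2 q = (Complex (q $ 1) (q $ 2), Complex (q $ 3) (- (q $ 4)))"

end

theory Submission
  imports Defs
begin

text \<open>
  The functions Re (c z1 z2 + g(z1) + h(z2)) with c constant and g, h holomorphic form a family that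
  is closed under all four partial derivatives and consists of differentiable functions; this gives
  smoothness. In the mixed derivatives of the equation the g and h parts drop out, and what remains
  are the mixed derivatives of Re (z1 z2) = q1 q3 + q2 q4.
\<close>

text \<open>Chain rule along the coordinate line through \<open>q\<close>: the one-variable
  \<open>deriv\<close> behind \<open>partial\<close> becomes the total derivative evaluated at a
  basis vector.\<close>

lemma partial_eq_has_derivative:
  assumes "(f has_derivative f') (at q)"
  shows "partial i f q = f' (axis i 1)"
proof -
  have "((\<lambda>t. q + t *\<^sub>R axis i 1) has_derivative (\<lambda>t. t *\<^sub>R axis i 1)) (at (0::real))"
    by (auto intro!: derivative_eq_intros)
  moreover have "(f has_derivative f') (at (q + 0 *\<^sub>R axis i 1))"
    using assms by simp
  ultimately have "((\<lambda>t. f (q + t *\<^sub>R axis i 1)) has_derivative (\<lambda>t. f' (t *\<^sub>R axis i 1))) (at 0)"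
    by (rule has_derivative_compose)
  moreover have "f' (t *\<^sub>R axis i 1) = f' (axis i 1) * t" for t
    using linear_cmul[OF has_derivative_linear[OF assms]] by simp
  ultimately have "((\<lambda>t. f (q + t *\<^sub>R axis i 1)) has_real_derivative f' (axis i 1)) (at 0)"
    by (simp add: has_field_derivative_def)
  then show ?thesis
    unfolding partial_def by (rule DERIV_imp_deriv)
qed

text \<open>For parameters near 0 the coordinate line through \<open>q\<close> stays in the open set
  \<open>D\<close>, and \<open>deriv\<close> depends only on values near the point.\<close>

lemma partial_cong_open:
  assumes "open D" "q \<in> D" "\<And>x. x \<in> D \<Longrightarrow> f x = g x"
  shows "partial i f q = partial i g q"
proof -
  have "((\<lambda>t. q + t *\<^sub>R axis i 1) \<longlongrightarrow> q + 0 *\<^sub>R axis i 1) (nhds (0::real))"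
    by (intro tendsto_intros filterlim_ident)
  with assms(1,2) have "\<forall>\<^sub>F t in nhds (0::real). q + t *\<^sub>R axis i 1 \<in> D"
    using topological_tendstoD by fastforce
  then have "\<forall>\<^sub>F t in nhds (0::real). f (q + t *\<^sub>R axis i 1) = g (q + t *\<^sub>R axis i 1)"
    by eventually_elim (rule assms(3))
  then show ?thesis
    unfolding partial_def by (intro deriv_cong_ev) auto
qed

text \<open>Closed forms of a function and of its partials are known only on \<open>D\<close>; this
  transfers regularity from them. The induction varies both functions because their partials take
  their place.\<close>

lemma C_k_on_cong_open:
  assumes "open D" "\<And>x. x \<in> D \<Longrightarrow> f x = g x" "C_k_on k g D"
  shows "C_k_on k f D"
  using assms(2,3)
proof (induction k arbitrary: f g)
  case 0
  then show ?case by (simp cong: continuous_on_cong)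
next
  case (Suc k)
  have "f differentiable at q" if q: "q \<in> D" for q
  proof -
    obtain g' where "(g has_derivative g') (at q)"
      using Suc.prems(2) q by (auto simp: differentiable_def)
    then have "(f has_derivative g') (at q)"
      using has_derivative_transform_within_open[OF _ assms(1) q] Suc.prems(1) by metis
    then show ?thesis by (auto simp: differentiable_def)
  qed
  moreover have "C_k_on k (partial i f) D" for i
  proof (rule Suc.IH)
    show "partial i f q = partial i g q" if "q \<in> D" for q
      using assms(1) that Suc.prems(1) by (rule partial_cong_open)
    show "C_k_on k (partial i g) D"
      using Suc.prems(2) by simp
  qed
  ultimately show ?case by simp
qed

abbreviation z1 :: "real ^ 4 \<Rightarrow> complex" where "z1 q \<equiv> fst (to_C2 q)"
abbreviation z2 :: "real ^ 4 \<Rightarrow> complex" where "z2 q \<equiv> snd (to_C2 q)"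

lemma bounded_linear_z1: "bounded_linear z1"
  and bounded_linear_z2: "bounded_linear z2"
  unfolding linear_conv_bounded_linear[symmetric]
  by (auto intro!: linearI simp: to_C2_def complex_eq_iff)

lemma continuous_on_to_C2: "continuous_on S to_C2"
proof -
  have "continuous_on S (\<lambda>q. (z1 q, z2 q))"
    by (intro continuous_on_Pair linear_continuous_on bounded_linear_z1 bounded_linear_z2)
  then show ?thesis by simp
qed

text \<open>As \<open>z1\<close> and \<open>z2\<close> are linear, these values are their constant
  partial derivatives.\<close>

lemma to_C2_axis:
  "to_C2 (axis 1 1) = (1, 0)" "to_C2 (axis 2 1) = (\<i>, 0)"
  "to_C2 (axis 3 1) = (0, 1)" "to_C2 (axis 4 1) = (0, - \<i>)"
  by (auto simp: to_C2_def axis_def complex_eq_iff)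

text \<open>The parameter \<open>c\<close> lets one family serve every order: \<open>c = 1\<close>
  covers the function of the theorem and \<open>c = 0\<close> its partial derivatives.\<close>

definition bilin_plus_hol ::
    "complex \<Rightarrow> (complex \<Rightarrow> complex) \<Rightarrow> (complex \<Rightarrow> complex) \<Rightarrow> real ^ 4 \<Rightarrow> real" where
  "bilin_plus_hol c g h q = Re (c * z1 q * z2 q + g (z1 q) + h (z2 q))"

context
  fixes A B :: "complex set" and D :: "(real ^ 4) set"
  assumes opens: "open A" "open B" "open D"
    and D_subset: "z1 ` D \<subseteq> A" "z2 ` D \<subseteq> B"
begin

lemma has_derivative_bilin_plus_hol:
  assumes "g holomorphic_on A" "h holomorphic_on B" "q \<in> D"
  shows "(bilin_plus_hol c g h has_derivative
    (\<lambda>v. Re (z1 v * (c * z2 q + deriv g (z1 q)) + z2 v * (c * z1 q + deriv h (z2 q))))) (at q)"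
proof -
  note [derivative_intros] =
    bounded_linear_imp_has_derivative[OF bounded_linear_z1]
    bounded_linear_imp_has_derivative[OF bounded_linear_z2]
  have "(g has_field_derivative deriv g (z1 q)) (at (z1 q))"
       "(h has_field_derivative deriv h (z2 q)) (at (z2 q))"
    using assms opens D_subset by (auto intro!: holomorphic_derivI)
  then have "(g has_derivative (\<lambda>v. deriv g (z1 q) * v)) (at (z1 q))"
       "(h has_derivative (\<lambda>v. deriv h (z2 q) * v)) (at (z2 q))"
    by (simp_all add: has_field_derivative_def)
  note [derivative_intros] =
    has_derivative_compose[OF bounded_linear_imp_has_derivative[OF bounded_linear_z1] this(1)]
    has_derivative_compose[OF bounded_linear_imp_has_derivative[OF bounded_linear_z2] this(2)]
  have "((\<lambda>q. Re (c * z1 q * z2 q + g (z1 q) + h (z2 q))) has_derivative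
    (\<lambda>v. Re (c * z1 q * z2 v + c * z1 v * z2 q + deriv g (z1 q) * z1 v + deriv h (z2 q) * z2 v))) (at q)"
    by (rule derivative_eq_intros refl)+ simp
  then show ?thesis
    unfolding bilin_plus_hol_def by (simp add: algebra_simps)
qed

text \<open>Differentiating the product term leaves a multiple of \<open>z1\<close> and a multiple
  of \<open>z2\<close>. Each is absorbed into the holomorphic part in that variable, hence the new
  coefficient 0.\<close>

lemma partial_bilin_plus_hol:
  assumes "g holomorphic_on A" "h holomorphic_on B" "q \<in> D"
  shows "partial i (bilin_plus_hol c g h) q =
    bilin_plus_hol 0 (\<lambda>z. z1 (axis i 1) * deriv g z + z2 (axis i 1) * c * z)
      (\<lambda>z. z2 (axis i 1) * deriv h z + z1 (axis i 1) * c * z) q"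
  unfolding partial_eq_has_derivative[OF has_derivative_bilin_plus_hol[OF assms]] bilin_plus_hol_def
  by (simp add: algebra_simps)

lemma C_k_on_bilin_plus_hol:
  assumes "g holomorphic_on A" "h holomorphic_on B"
  shows "C_k_on k (bilin_plus_hol c g h) D"
  using assms
proof (induction k arbitrary: c g h)
  case 0
  have "bilin_plus_hol c g h differentiable at q" if "q \<in> D" for q
    using has_derivative_bilin_plus_hol[OF 0 that] differentiableI by blast
  then show ?case
    by (simp add: continuous_at_imp_continuous_on differentiable_imp_continuous_within)
next
  case (Suc k)
  have "C_k_on k (partial i (bilin_plus_hol c g h)) D" for i
    \<comment> \<open>The new parts are holomorphic on the same \<open>A\<close> and
      \<open>B\<close>, so the induction hypothesis applies to the closed form of the
      partial.\<close>
    by (rule C_k_on_cong_open[OF opens(3) partial_bilin_plus_hol[OF Suc.prems]], assumption,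
        rule Suc.IH)
      (intro holomorphic_intros holomorphic_deriv Suc.prems opens)+
  then show ?case
    using has_derivative_bilin_plus_hol[OF Suc.prems] differentiableI by simp blast
qed

text \<open>The first-order formula is applied twice, the second time with coefficient 0. If one
  index is 1 or 2 and the other 3 or 4, then \<open>to_C2_axis\<close> kills both second-derivative
  terms and only the term with \<open>c\<close> survives.\<close>

lemma partial_partial_bilin_plus_hol:
  assumes "g holomorphic_on A" "h holomorphic_on B" "q \<in> D"
  shows "partial i (partial j (bilin_plus_hol c g h)) q =
    Re (z1 (axis i 1) * z1 (axis j 1) * deriv (deriv g) (z1 q)
      + c * (z1 (axis i 1) * z2 (axis j 1) + z2 (axis i 1) * z1 (axis j 1))
      + z2 (axis i 1) * z2 (axis j 1) * deriv (deriv h) (z2 q))"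
proof -
  let ?\<alpha> = "z1 (axis j 1)" and ?\<beta> = "z2 (axis j 1)"
  let ?g = "\<lambda>z. ?\<alpha> * deriv g z + ?\<beta> * c * z" and ?h = "\<lambda>z. ?\<beta> * deriv h z + ?\<alpha> * c * z"
  have hol: "?g holomorphic_on A" "?h holomorphic_on B"
    by (intro holomorphic_intros holomorphic_deriv assms opens)+
  have q: "z1 q \<in> A" "z2 q \<in> B"
    using D_subset assms(3) by auto
  have "(deriv g has_field_derivative deriv (deriv g) (z1 q)) (at (z1 q))"
       "(deriv h has_field_derivative deriv (deriv h) (z2 q)) (at (z2 q))"
    using assms opens q by (auto intro!: holomorphic_derivI holomorphic_deriv)
  then have deriv_gh:
    "deriv ?g (z1 q) = ?\<alpha> * deriv (deriv g) (z1 q) + ?\<beta> * c"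
    "deriv ?h (z2 q) = ?\<beta> * deriv (deriv h) (z2 q) + ?\<alpha> * c"
    by (auto intro!: DERIV_imp_deriv derivative_eq_intros)
  have "partial i (partial j (bilin_plus_hol c g h)) q = partial i (bilin_plus_hol 0 ?g ?h) q"
    using partial_bilin_plus_hol[OF assms(1,2)] by (intro partial_cong_open[OF opens(3) assms(3)])
  then show ?thesis
    unfolding partial_bilin_plus_hol[OF hol assms(3)] bilin_plus_hol_def deriv_gh
    by (simp only: mult_zero_left mult_zero_right add_0 algebra_simps)
qed

end

theorem proposition6:
  fixes U :: "(complex \<times> complex) set"
    and \<phi> :: "complex \<times> complex \<Rightarrow> complex"
    and a b :: "complex \<Rightarrow> complex"
  assumes "open U"
    and "a holomorphic_on fst ` U"
    and "b holomorphic_on snd ` U"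
    and "\<And>z1 z2. (z1, z2) \<in> U \<Longrightarrow> \<phi> (z1, z2) = z1 * z2 + a z1 + b z2"
  shows "plebanski_I_regular_solution (to_C2 -` U) (\<lambda>q. Re (\<phi> (to_C2 q)))"
proof -
  let ?D = "to_C2 -` U" and ?f = "\<lambda>q. Re (\<phi> (to_C2 q))" and ?F = "bilin_plus_hol 1 a b"
  have opens: "open (fst ` U)" "open (snd ` U)" "open ?D"
    using assms(1) continuous_on_to_C2[of UNIV]
    by (auto intro: open_image_fst open_image_snd open_vimage)
  have sub: "z1 ` ?D \<subseteq> fst ` U" "z2 ` ?D \<subseteq> snd ` U"
    by auto
  \<comment> \<open>Since \<open>\<phi>\<close> is prescribed only on \<open>U\<close>, the two
    functions need not agree outside \<open>?D\<close>.\<close>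
  have eq: "?f q = ?F q" if "q \<in> ?D" for q
    using that assms(4)[of "z1 q" "z2 q"] by (simp add: bilin_plus_hol_def)
  have "smooth_on ?D ?f"
    unfolding smooth_on_def
    using C_k_on_cong_open[of ?D ?f ?F, OF opens(3) eq]
      C_k_on_bilin_plus_hol[OF opens sub assms(2,3)] by blast
  \<comment> \<open>The outer derivative needs the inner ones to agree on all of \<open>?D\<close>,
    so the congruence is used twice.\<close>
  moreover have pp: "partial i (partial j ?f) q = partial i (partial j ?F) q" if "q \<in> ?D" for i j q
    using partial_cong_open[OF opens(3) that partial_cong_open[of ?D _ ?f ?F, OF opens(3) _ eq]] .
  ultimately show ?thesis
    unfolding plebanski_I_regular_solution_def
    \<comment> \<open>The index pairs (1,3) and (2,4) give 1, the latter as \<i> * (- \<i>); the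
      pairs (1,4) and (2,3) give the real parts of - \<i> and \<i>, which are 0. Deleting
      \<open>vimage_eq\<close> keeps membership in \<open>?D\<close> in the form of the side
      conditions.\<close>
    by (simp add: opens(3) pp partial_partial_bilin_plus_hol[OF opens sub assms(2,3)] to_C2_axis
      del: vimage_eq)
qed

end
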